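(* Let $S$ be a finite semigroup. Then $\mathbf{C}(S)$ is a free semigroup if and only if the minimal ideal $K$ of $S$ consists of a single $\mathcal{R}$-class, in which every $\mathcal{H}$-class is not a singleton, and there exists $k\in K$ such that $st=skt$ for all $s,t\in S$.
   Context: Cayley automaton semigroup: for a finite (non-empty) semigroup $S$, the Cayley automaton $\mathcal{C}(S)$ has state set $S$ and alphabet $S$; when in state $s$ (written $\overline{s}$ to distinguish states from symbols) and reading a symbol $t$, it outputs $st$ and moves to state $\overline{st}$. Thus each state defines a transformation $\overline{s}$ of the set $S^{\infty}$ of infinite sequences over $S$, given by $(x_1,x_2,x_3,\ldots)\cdot\overline{s}=(sx_1,\,sx_1x_2,\,sx_1x_2x_3,\ldots)$. Transformations act on the right and are composed left to right: $\alpha\cdot(\overline{s}\cdot\overline{t})=(\alpha\cdot\overline{s})\cdot\overline{t}$. $\mathbf{C}(S)$ is the semigroup of transformations of $S^{\infty}$ generated by $\{\overline{s}:s\in S\}$. $\mathcal{R}$ and $\mathcal{H}$ denote Green's relations on $S$. A free semigroup is the semigroup of non-empty words over a non-empty set. *)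

theory Defs
  imports Main
begin

text \<open>A finite semigroup \<open>S\<close> is a type of class \<open>{semigroup_mult, finite}\<close> (non-empty, as every
  type is); \<open>S\<close>-valued infinite sequences are functions \<open>nat \<Rightarrow> 'a\<close>, so \<open>x 0\<close> is the first symbol.\<close>

section \<open>Ideals and Green's relations\<close>

definition is_ideal :: "'a::semigroup_mult set \<Rightarrow> bool" where
  "is_ideal I \<longleftrightarrow> I \<noteq> {} \<and> (\<forall>a\<in>I. \<forall>s. s * a \<in> I \<and> a * s \<in> I)"

definition is_minimal_ideal :: "'a::semigroup_mult set \<Rightarrow> bool" where
  "is_minimal_ideal K \<longleftrightarrow> is_ideal K \<and> (\<forall>I. is_ideal I \<and> I \<subseteq> K \<longrightarrow> I = K)"

text \<open>The principal one-sided ideals \<open>aS\<^sup>1\<close> and \<open>S\<^sup>1a\<close>; adjoining an identity to \<open>S\<close>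
  only contributes the element \<open>a\<close> itself.\<close>

definition right_principal :: "'a::semigroup_mult \<Rightarrow> 'a set" where
  "right_principal a = insert a (range (\<lambda>s. a * s))"

definition left_principal :: "'a::semigroup_mult \<Rightarrow> 'a set" where
  "left_principal a = insert a (range (\<lambda>s. s * a))"

definition green_R :: "('a::semigroup_mult \<times> 'a) set" where
  "green_R = {(a, b). right_principal a = right_principal b}"

definition green_L :: "('a::semigroup_mult \<times> 'a) set" where
  "green_L = {(a, b). left_principal a = left_principal b}"

definition green_H :: "('a::semigroup_mult \<times> 'a) set" where
  "green_H = green_R \<inter> green_L"

lemma equiv_green_R: "equiv UNIV green_R"
  by (simp add: equiv_def refl_on_def sym_def trans_def green_R_def)

lemma equiv_green_H: "equiv UNIV green_H"
  by (simp add: equiv_def refl_on_def sym_def trans_def green_H_def green_R_def green_L_def)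

text \<open>A finite semigroup has exactly one minimal ideal.\<close>

lemma ex1_minimal_ideal: "\<exists>!K :: 'a::{semigroup_mult, finite} set. is_minimal_ideal K"
proof (rule ex_ex1I)
  let ?F = "{I :: 'a set. is_ideal I}"
  have "UNIV \<in> ?F" by (auto simp: is_ideal_def)
  then obtain K where "K \<in> ?F" "\<forall>I\<in>?F. I \<subseteq> K \<longrightarrow> K = I"
    using finite_has_minimal[of ?F] by auto
  then show "\<exists>K :: 'a set. is_minimal_ideal K"
    unfolding is_minimal_ideal_def by blast
next
  fix K L :: "'a set"
  assume K: "is_minimal_ideal K" and L: "is_minimal_ideal L"
  then have idK: "is_ideal K" and idL: "is_ideal L"
    and minK: "\<And>I. is_ideal I \<Longrightarrow> I \<subseteq> K \<Longrightarrow> I = K"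
    and minL: "\<And>I. is_ideal I \<Longrightarrow> I \<subseteq> L \<Longrightarrow> I = L"
    by (simp_all add: is_minimal_ideal_def)
  from idK idL obtain a b where ab: "a \<in> K" "b \<in> L"
    unfolding is_ideal_def by blast
  have "a * b \<in> K"
    using idK ab(1) by (simp add: is_ideal_def)
  moreover have "a * b \<in> L"
    using idL ab(2) by (simp add: is_ideal_def)
  ultimately have "K \<inter> L \<noteq> {}"
    by blast
  then have "is_ideal (K \<inter> L)"
    using idK idL by (simp add: is_ideal_def)
  then show "K = L"
    using minK[of "K \<inter> L"] minL[of "K \<inter> L"] by blast
qed

section \<open>Cayley automaton semigroups\<close>

text \<open>\<open>cayley_run s x n\<close> is the state reached by the Cayley automaton from the state \<open>s\<close> after reading
  \<open>x 0, \<dots>, x (n - 1)\<close>. In state \<open>q\<close> and reading \<open>t\<close>, the automaton moves to \<open>q * t\<close> and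
  outputs \<open>q * t\<close>.\<close>

primrec cayley_run :: "'a::semigroup_mult \<Rightarrow> (nat \<Rightarrow> 'a) \<Rightarrow> nat \<Rightarrow> 'a" where
  "cayley_run s x 0 = s"
| "cayley_run s x (Suc n) = cayley_run s x n * x n"

definition cayley_map :: "'a::semigroup_mult \<Rightarrow> (nat \<Rightarrow> 'a) \<Rightarrow> (nat \<Rightarrow> 'a)" where
  "cayley_map s x = (\<lambda>n. cayley_run s x n * x n)"

lemma cayley_map_0: "cayley_map s x 0 = s * x 0"
  by (simp add: cayley_map_def)

lemma cayley_map_Suc: "cayley_map s x (Suc n) = cayley_map s x n * x (Suc n)"
  by (simp add: cayley_map_def)

text \<open>Transformations act on the right, so the product of \<open>f\<close> and \<open>g\<close> applies \<open>f\<close> first.\<close>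

definition trans_mult :: "('b \<Rightarrow> 'b) \<Rightarrow> ('b \<Rightarrow> 'b) \<Rightarrow> ('b \<Rightarrow> 'b)" where
  "trans_mult f g = g \<circ> f"

inductive_set cayley_semigroup :: "((nat \<Rightarrow> 'a::semigroup_mult) \<Rightarrow> (nat \<Rightarrow> 'a)) set" where
  gen: "cayley_map s \<in> cayley_semigroup"
| mult: "f \<in> cayley_semigroup \<Longrightarrow> g \<in> cayley_semigroup \<Longrightarrow> trans_mult f g \<in> cayley_semigroup"

section \<open>Free semigroups\<close>

definition nonempty_words :: "'b set \<Rightarrow> 'b list set" where
  "nonempty_words X = {w. w \<noteq> [] \<and> set w \<subseteq> X}"

text \<open>The semigroup with carrier \<open>M\<close> and operation \<open>m\<close> is free if it is isomorphic to the semigroup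
  of non-empty words over some non-empty set \<open>X\<close>. Taking \<open>X\<close> in the type of the elements of
  \<open>M\<close> is no restriction: an isomorphism embeds the alphabet into \<open>M\<close> via one-letter words.\<close>

definition is_free_semigroup :: "'b set \<Rightarrow> ('b \<Rightarrow> 'b \<Rightarrow> 'b) \<Rightarrow> bool" where
  "is_free_semigroup M m \<longleftrightarrow>
     (\<exists>(X :: 'b set) \<phi>. X \<noteq> {} \<and> bij_betw \<phi> (nonempty_words X) M \<and>
        (\<forall>u\<in>nonempty_words X. \<forall>v\<in>nonempty_words X. \<phi> (u @ v) = m (\<phi> u) (\<phi> v)))"

end

theory Submission
  imports Defs
begin

text \<open>
  Reading a letter \<open>t\<close> turns a word of states \<open>g\<^sub>1\<dots>g\<^sub>n\<close> into its section
  \<open>(g\<^sub>1t)(g\<^sub>2g\<^sub>1t)\<dots>(g\<^sub>n\<dots>g\<^sub>1t)\<close>, whose last letter is the output.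
  Words acting equally therefore have sections with the same last letter. If the action is free,
  comparing the lengths of a generator and of its sections shows that the generators themselves form
  the basis. Hence \<open>ba = ca\<close>, which makes the words \<open>a b\<close> and \<open>a c\<close> act equally, implies
  \<open>bx = cx\<close> for all \<open>x\<close>; applied to idempotents \<open>a \<in> K\<close> this yields all three conditions.
  Conversely, the conditions provide an idempotent \<open>e \<in> K\<close> for which \<open>Se\<close> is a non-trivial
  group and each \<open>s\<close> acts as \<open>se\<close>; in a group the last letter of the section can be cancelled,
  so that induction on the length proves freeness.
\<close>

section \<open>Ideals, idempotents and Green's relations\<close>

lemma is_ideal_mult:
  assumes "is_ideal K" "a \<in> K"
  shows "s * a \<in> K" "a * s \<in> K"
  using assms by (auto simp: is_ideal_def)

lemma right_principal_mult: "x \<in> right_principal a \<Longrightarrow> x * y \<in> right_principal a"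
  by (auto simp: right_principal_def mult.assoc)

lemma left_principal_mult: "y \<in> left_principal a \<Longrightarrow> x * y \<in> left_principal a"
  by (auto simp: left_principal_def mult.assoc[symmetric])

lemma right_principal_self: "a \<in> right_principal a"
  by (simp add: right_principal_def)

lemma left_principal_self: "a \<in> left_principal a"
  by (simp add: left_principal_def)

lemma left_principal_mono: "b \<in> left_principal a \<Longrightarrow> left_principal b \<subseteq> left_principal a"
  by (auto simp: left_principal_def mult.assoc[symmetric])

lemma left_principal_eqI:
  "a \<in> left_principal b \<Longrightarrow> b \<in> left_principal a \<Longrightarrow> left_principal a = left_principal b"
  using left_principal_mono by blast

lemma right_principal_in_ideal: "is_ideal K \<Longrightarrow> a \<in> K \<Longrightarrow> right_principal a \<subseteq> K"
  by (auto simp: right_principal_def is_ideal_mult)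

lemma idempotent_right_principal:
  "e * e = e \<Longrightarrow> x \<in> right_principal e \<Longrightarrow> e * x = x"
  by (auto simp: right_principal_def mult.assoc[symmetric])

lemma idempotent_left_principal:
  "e * e = e \<Longrightarrow> x \<in> left_principal e \<Longrightarrow> x * e = x"
  by (auto simp: left_principal_def mult.assoc)

text \<open>Take a minimal subsemigroup \<open>T\<close> of \<open>A\<close> and \<open>a\<close> in
  \<open>T\<close>. Minimality gives \<open>T = aT\<close>, so some \<open>t\<close> in
  \<open>T\<close> fixes \<open>a\<close> on the right. The right stabiliser of \<open>a\<close> in
  \<open>T\<close> is then a non-empty subsemigroup, hence all of \<open>T\<close>, and contains
  \<open>a\<close> itself.\<close>

lemma idempotent_in_subsemigroup:
  fixes A :: "'a::{semigroup_mult, finite} set"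
  assumes ne: "A \<noteq> {}" and closed: "\<And>x y. x \<in> A \<Longrightarrow> y \<in> A \<Longrightarrow> x * y \<in> A"
  obtains e where "e \<in> A" "e * e = e"
proof -
  let ?F = "{T. T \<noteq> {} \<and> T \<subseteq> A \<and> (\<forall>x\<in>T. \<forall>y\<in>T. x * y \<in> T)}"
  have "A \<in> ?F"
    using ne closed by auto
  then obtain T where T: "T \<in> ?F" and min: "\<forall>U\<in>?F. U \<subseteq> T \<longrightarrow> T = U"
    using finite_has_minimal[of ?F] by (metis (no_types, lifting) empty_iff finite)
  from T obtain a where a: "a \<in> T" by auto
  have "(*) a ` T \<in> ?F"
  proof -
    have "x * (a * y) \<in> T" if "x \<in> T" "y \<in> T" for x y
      using T a that by auto
    then show ?thesis
      using T a by (auto simp: mult.assoc)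
  qed
  moreover have "(*) a ` T \<subseteq> T"
    using T a by auto
  ultimately have "T = (*) a ` T"
    using min by blast
  then obtain t where t: "t \<in> T" "a * t = a"
    using a by (metis imageE)
  let ?U = "{t \<in> T. a * t = a}"
  have "?U \<in> ?F"
    using T t by (auto simp: mult.assoc[symmetric])
  moreover have "?U \<subseteq> T"
    by blast
  ultimately have "T = ?U"
    by (rule min[rule_format])
  then have "a * a = a"
    using a by blast
  moreover have "a \<in> A"
    using a T by blast
  ultimately show thesis
    using that by simp
qed

text \<open>Stands in for the idempotent power of \<open>a\<close>. Powers are avoided by taking an
  idempotent in the subsemigroup of all elements that have the wanted properties; \<open>a\<close>
  belongs to it.\<close>

lemma idempotent_power:
  fixes a :: "'a::{semigroup_mult, finite}"
  obtains e where "e * e = e" "a * e = e * a" "e \<in> right_principal a" "e \<in> left_principal a"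
proof -
  let ?A = "{x. a * x = x * a} \<inter> right_principal a \<inter> left_principal a"
  have "a \<in> ?A"
    by (simp add: right_principal_self left_principal_self)
  moreover have "x * y \<in> ?A" if xy: "x \<in> ?A" "y \<in> ?A" for x y
  proof -
    have "a * x = x * a" "a * y = y * a"
      using xy by auto
    then have "a * (x * y) = x * y * a"
      by (metis mult.assoc)
    then show ?thesis
      using xy by (simp add: right_principal_mult left_principal_mult)
  qed
  ultimately obtain e where "e \<in> ?A" "e * e = e"
    using idempotent_in_subsemigroup[of ?A] by blast
  then show thesis
    using that by blast
qed

section \<open>Self-similarity: the action of words of states and their sections\<close>

lemma cayley_map_case_nat:
  "cayley_map s (case_nat t x) = case_nat (s * t) (cayley_map (s * t) x)"
proof
  fix n
  show "cayley_map s (case_nat t x) n = case_nat (s * t) (cayley_map (s * t) x) n"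
    by (induction n) (simp_all add: cayley_map_0 cayley_map_Suc split: nat.split)
qed

lemma cayley_map_eqI:
  assumes "\<And>x. a * x = b * x"
  shows "cayley_map a = cayley_map b"
proof (intro ext)
  fix x n
  show "cayley_map a x n = cayley_map b x n"
    by (induction n) (simp_all add: cayley_map_0 cayley_map_Suc assms)
qed

lemma cayley_map_eqD: "cayley_map a = cayley_map b \<Longrightarrow> a * x = b * x"
  using cayley_map_0[of a "\<lambda>_. x"] cayley_map_0[of b "\<lambda>_. x"] by simp

text \<open>The recursive call receives \<open>g * t\<close> because the output of one automaton is
  the input of the next; this symbol is at the same time the new state of \<open>g\<close>.\<close>

primrec section_word :: "'a::semigroup_mult list \<Rightarrow> 'a \<Rightarrow> 'a list" where
  "section_word [] t = []"
| "section_word (g # w) t = (g * t) # section_word w (g * t)"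

lemma length_section_word [simp]: "length (section_word w t) = length w"
  by (induction w arbitrary: t) auto

lemma section_word_eq_Nil_iff [simp]: "section_word w t = [] \<longleftrightarrow> w = []"
  by (cases w) auto

lemma section_word_snoc:
  "section_word (w @ [g]) t = section_word w t @ [fold (*) (w @ [g]) t]"
  by (induction w arbitrary: t) auto

lemma fold_cayley_map_case_nat:
  "fold cayley_map w (case_nat t x) =
     case_nat (fold (*) w t) (fold cayley_map (section_word w t) x)"
  by (induction w arbitrary: t x) (auto simp: cayley_map_case_nat)

lemma cayley_word_eqD:
  assumes "fold cayley_map v (case_nat t x) = fold cayley_map w (case_nat t x)"
  shows "fold (*) v t = fold (*) w t"
    and "fold cayley_map (section_word v t) x = fold cayley_map (section_word w t) x"
proof -
  have eq: "case_nat (fold (*) v t) (fold cayley_map (section_word v t) x) =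
      case_nat (fold (*) w t) (fold cayley_map (section_word w t) x)"
    using assms by (simp add: fold_cayley_map_case_nat)
  show "fold (*) v t = fold (*) w t"
    using fun_cong[OF eq, of 0] by simp
  show "fold cayley_map (section_word v t) x = fold cayley_map (section_word w t) x"
  proof
    fix n
    show "fold cayley_map (section_word v t) x n = fold cayley_map (section_word w t) x n"
      using fun_cong[OF eq, of "Suc n"] by simp
  qed
qed

section \<open>Freeness in terms of words of states\<close>

lemma cayley_semigroup_eq: "cayley_semigroup = fold cayley_map ` {w. w \<noteq> []}"
proof (intro equalityI subsetI)
  fix f :: "(nat \<Rightarrow> 'a) \<Rightarrow> nat \<Rightarrow> 'a"
  assume "f \<in> cayley_semigroup"
  then show "f \<in> fold cayley_map ` {w. w \<noteq> []}"
  proof induction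
    case (gen s)
    have "cayley_map s = fold cayley_map [s]"
      by simp
    then show ?case
      by blast
  next
    case (mult f g)
    then obtain v w where "f = fold cayley_map v" "g = fold cayley_map w" "v \<noteq> []"
      by blast
    then have "trans_mult f g = fold cayley_map (v @ w)" "v @ w \<noteq> []"
      by (auto simp: trans_mult_def)
    then show ?case
      by blast
  qed
next
  fix f :: "(nat \<Rightarrow> 'a) \<Rightarrow> nat \<Rightarrow> 'a"
  assume "f \<in> fold cayley_map ` {w. w \<noteq> []}"
  then obtain w where "w \<noteq> []" "f = fold cayley_map w"
    by blast
  moreover have "fold cayley_map w \<in> cayley_semigroup" if "w \<noteq> []" for w :: "'a list"
    using that
  proof (induction w rule: rev_nonempty_induct)
    case (single x)
    then show ?case
      by (simp add: cayley_semigroup.gen)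
  next
    case (snoc x xs)
    then have "trans_mult (fold cayley_map xs) (cayley_map x) \<in> cayley_semigroup"
      by (intro cayley_semigroup.intros)
    then show ?case
      by (simp add: trans_mult_def comp_def)
  qed
  ultimately show "f \<in> cayley_semigroup"
    by simp
qed

text \<open>The generators serve as the basis, with \<open>fold id\<close> multiplying out a word of
  maps. The words are compared only after \<open>map cayley_map\<close>, since different states may
  define the same map.\<close>

lemma cayley_semigroup_freeI:
  assumes inj: "\<And>v w :: 'a::semigroup_mult list. v \<noteq> [] \<Longrightarrow> w \<noteq> [] \<Longrightarrow>
    fold cayley_map v = fold cayley_map w \<Longrightarrow> map cayley_map v = map cayley_map w"
  shows "is_free_semigroup (cayley_semigroup :: ((nat \<Rightarrow> 'a) \<Rightarrow> (nat \<Rightarrow> 'a)) set) trans_mult"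
proof -
  let ?X = "range (cayley_map :: 'a \<Rightarrow> _)"
  have words: "nonempty_words ?X = map cayley_map ` {w. w \<noteq> []}"
  proof -
    have "nonempty_words ?X = lists ?X - {[]}"
      by (auto simp: nonempty_words_def lists_eq_set)
    also have "\<dots> = map cayley_map ` {w. w \<noteq> []}"
      by (auto simp: lists_image)
    finally show ?thesis .
  qed
  have fold: "fold id (map cayley_map w) = fold cayley_map w" for w :: "'a list"
    by (simp add: fold_map)
  have "inj_on (fold id) (nonempty_words ?X)"
    unfolding words
  proof (rule inj_onI, clarify)
    fix v w :: "'a list"
    assume "v \<noteq> []" "w \<noteq> []" "fold id (map cayley_map v) = fold id (map cayley_map w)"
    then show "map cayley_map v = map cayley_map w"
      unfolding fold by (rule inj)
  qed
  moreover have "fold id ` nonempty_words ?X = cayley_semigroup"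
    unfolding words cayley_semigroup_eq by (simp add: image_image fold)
  ultimately have "bij_betw (fold id) (nonempty_words ?X) cayley_semigroup"
    by (simp add: bij_betw_def)
  moreover have "fold id (u @ v) = trans_mult (fold id u) (fold id v)"
    for u v :: "((nat \<Rightarrow> 'a) \<Rightarrow> (nat \<Rightarrow> 'a)) list"
    by (simp add: trans_mult_def)
  ultimately show ?thesis
    unfolding is_free_semigroup_def by blast
qed

text \<open>With \<open>\<psi>\<close> the inverse of the isomorphism, it suffices that every
  generator has a \<open>\<psi>\<close>-image of length one; the letters of a word can then be read
  off from its image.\<close>

lemma cayley_semigroup_freeD:
  fixes v w :: "'a::semigroup_mult list"
  assumes free: "is_free_semigroup (cayley_semigroup :: ((nat \<Rightarrow> 'a) \<Rightarrow> (nat \<Rightarrow> 'a)) set) trans_mult"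
    and ne: "v \<noteq> []" "w \<noteq> []" and eq: "fold cayley_map v = fold cayley_map w"
  shows "map cayley_map v = map cayley_map w"
proof -
  let ?M = "cayley_semigroup :: ((nat \<Rightarrow> 'a) \<Rightarrow> (nat \<Rightarrow> 'a)) set"
  from free obtain X :: "((nat \<Rightarrow> 'a) \<Rightarrow> (nat \<Rightarrow> 'a)) set" and \<phi>
    where bij: "bij_betw \<phi> (nonempty_words X) ?M"
    and hom: "\<And>u v. u \<in> nonempty_words X \<Longrightarrow> v \<in> nonempty_words X \<Longrightarrow>
      \<phi> (u @ v) = trans_mult (\<phi> u) (\<phi> v)"
    unfolding is_free_semigroup_def by blast
  define \<psi> where "\<psi> = inv_into (nonempty_words X) \<phi>"
  have \<psi>: "\<psi> f \<in> nonempty_words X" "\<phi> (\<psi> f) = f" if "f \<in> ?M" for f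
    using that bij unfolding \<psi>_def by (auto simp: bij_betw_def inv_into_into f_inv_into_f)
  have \<psi>\<phi>: "\<psi> (\<phi> u) = u" if "u \<in> nonempty_words X" for u
    using that bij unfolding \<psi>_def by (simp add: bij_betw_def)
  have \<psi>_mult: "\<psi> (trans_mult f g) = \<psi> f @ \<psi> g" if "f \<in> ?M" "g \<in> ?M" for f g
  proof -
    have "\<psi> f @ \<psi> g \<in> nonempty_words X"
      using \<psi>(1)[OF that(1)] \<psi>(1)[OF that(2)] by (auto simp: nonempty_words_def)
    then show ?thesis
      using \<psi>\<phi> hom \<psi> that by metis
  qed
  have word_in: "fold cayley_map w \<in> ?M" if "w \<noteq> []" for w
    using that by (auto simp: cayley_semigroup_eq)
  have \<psi>_word: "\<psi> (fold cayley_map w) = concat (map (\<lambda>a. \<psi> (cayley_map a)) w)"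
    if "w \<noteq> []" for w
    using that
  proof (induction w rule: rev_nonempty_induct)
    case (single x)
    then show ?case by simp
  next
    case (snoc x xs)
    have "fold cayley_map (xs @ [x]) = trans_mult (fold cayley_map xs) (cayley_map x)"
      by (simp add: trans_mult_def)
    moreover have "\<psi> (trans_mult (fold cayley_map xs) (cayley_map x)) =
        \<psi> (fold cayley_map xs) @ \<psi> (cayley_map x)"
      using snoc by (intro \<psi>_mult word_in cayley_semigroup.gen)
    ultimately show ?case
      using snoc by (simp only: map_append concat_append) simp
  qed
  have \<psi>_ne: "\<psi> (cayley_map a) \<noteq> []" for a
    using \<psi>(1)[OF cayley_semigroup.gen, of a] by (simp add: nonempty_words_def)
  \<comment> \<open>A proper product has a \<open>\<psi>\<close>-image of length at least two, so a
    basis element has to be a generator.\<close>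
  have letters: "\<exists>a. \<phi> [x] = cayley_map a" if "x \<in> X" for x
  proof -
    have x: "[x] \<in> nonempty_words X"
      using that by (simp add: nonempty_words_def)
    then have "\<phi> [x] \<in> ?M"
      using bij by (auto simp: bij_betw_def)
    then show ?thesis
    proof cases
      case (gen s)
      then show ?thesis by blast
    next
      case (mult f g)
      then have "[x] = \<psi> f @ \<psi> g"
        using \<psi>\<phi>[OF x] \<psi>_mult by simp
      moreover have "\<psi> f \<noteq> []" "\<psi> g \<noteq> []"
        using \<psi>(1)[OF mult(2)] \<psi>(1)[OF mult(3)] by (auto simp: nonempty_words_def)
      ultimately show ?thesis
        by (cases "\<psi> f") auto
    qed
  qed
  then obtain c where c: "\<And>x. x \<in> X \<Longrightarrow> \<phi> [x] = cayley_map (c x)"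
    by metis
  have single: "length (\<psi> (cayley_map s)) = 1" for s :: 'a
  proof -
    have u: "\<psi> (cayley_map s) \<noteq> []" "set (\<psi> (cayley_map s)) \<subseteq> X"
      using \<psi>(1)[OF cayley_semigroup.gen, of s] by (auto simp: nonempty_words_def)
    \<comment> \<open>Spells the basis word of \<open>cayley_map s\<close> in states, so that
      sections can be taken.\<close>
    define w where "w = map c (\<psi> (cayley_map s))"
    have w: "map cayley_map w = map (\<lambda>x. \<phi> [x]) (\<psi> (cayley_map s))"
      using u(2) by (auto simp: w_def c)
    have len: "length w = length (\<psi> (cayley_map s))"
      by (simp add: w_def)
    have "fold cayley_map w = cayley_map s"
    proof -
      have "\<phi> u = fold id (map (\<lambda>x. \<phi> [x]) u)" if "u \<noteq> []" "set u \<subseteq> X" for u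
        using that
      proof (induction u rule: rev_nonempty_induct)
        case (single x)
        then show ?case by simp
      next
        case (snoc x xs)
        then have "\<phi> (xs @ [x]) = trans_mult (\<phi> xs) (\<phi> [x])"
          by (intro hom) (auto simp: nonempty_words_def)
        then show ?case
          using snoc by (simp add: trans_mult_def)
      qed
      then have "\<phi> (\<psi> (cayley_map s)) = fold id (map cayley_map w)"
        using u w by simp
      then show ?thesis
        using \<psi>(2)[OF cayley_semigroup.gen] by (simp add: fold_map)
    qed
    then have eq: "fold cayley_map w x = fold cayley_map [s] x" for x
      by simp
    have "w \<noteq> []"
      using len u by auto
    then obtain w' g where w': "w = w' @ [g]"
      by (metis rev_exhaust)
    \<comment> \<open>The section of \<open>w\<close> ends in the state \<open>s * s\<close>, which alone already acts as the whole
      section does; so nothing can precede it.\<close>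
    have "fold cayley_map (section_word w s) = cayley_map (s * s)"
      using cayley_word_eqD(2)[OF eq] by auto
    moreover have "section_word w s = section_word w' s @ [s * s]"
      using cayley_word_eqD(1)[OF eq, of s] unfolding w' section_word_snoc by simp
    ultimately have "\<psi> (cayley_map (s * s)) =
        concat (map (\<lambda>a. \<psi> (cayley_map a)) (section_word w' s @ [s * s]))"
      using \<psi>_word by (metis snoc_eq_iff_butlast)
    then have "concat (map (\<lambda>a. \<psi> (cayley_map a)) (section_word w' s)) = []"
      by simp
    then have "section_word w' s = []"
      using \<psi>_ne by (cases "section_word w' s") simp_all
    then show ?thesis
      using len w' by simp
  qed
  define h where "h a = hd (\<psi> (cayley_map a))" for a :: 'a
  have h: "\<psi> (cayley_map a) = [h a]" for a
    using single[of a] unfolding h_def by (cases "\<psi> (cayley_map a)") auto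
  have "concat (map (\<lambda>a. [h a]) v) = concat (map (\<lambda>a. [h a]) w)"
    using \<psi>_word[OF ne(1)] \<psi>_word[OF ne(2)] eq by (simp add: h)
  then have "map h v = map h w"
    by simp
  then have "map (\<lambda>x. \<phi> [x]) (map h v) = map (\<lambda>x. \<phi> [x]) (map h w)"
    by simp
  moreover have "\<phi> [h a] = cayley_map a" for a
    using \<psi>(2)[OF cayley_semigroup.gen, of a] by (simp add: h)
  ultimately show ?thesis
    by (simp add: comp_def)
qed

section \<open>Words over a cancellative subsemigroup are determined by their action\<close>

locale cancellative_subsemigroup =
  fixes G :: "'a::semigroup_mult set"
  assumes closed: "a \<in> G \<Longrightarrow> b \<in> G \<Longrightarrow> a * b \<in> G"
    and left_cancel: "a \<in> G \<Longrightarrow> b \<in> G \<Longrightarrow> c \<in> G \<Longrightarrow> a * b = a * c \<Longrightarrow> b = c"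
    and right_cancel: "a \<in> G \<Longrightarrow> b \<in> G \<Longrightarrow> c \<in> G \<Longrightarrow> b * a = c * a \<Longrightarrow> b = c"
begin

text \<open>The input is restricted to sequences over \<open>G\<close>, because cancellation is
  available only there; states from \<open>G\<close> preserve such sequences.\<close>

definition acts_equally :: "'a list \<Rightarrow> 'a list \<Rightarrow> bool" where
  "acts_equally v w \<longleftrightarrow> (\<forall>x. range x \<subseteq> G \<longrightarrow> fold cayley_map v x = fold cayley_map w x)"

lemma cayley_map_closed:
  assumes "s \<in> G" "range x \<subseteq> G"
  shows "range (cayley_map s x) \<subseteq> G"
proof -
  have "cayley_map s x n \<in> G" for n
    using assms by (induction n) (auto simp: cayley_map_0 cayley_map_Suc intro!: closed)
  then show ?thesis
    by blast
qed

lemma fold_cayley_map_closed: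
  "set w \<subseteq> G \<Longrightarrow> range x \<subseteq> G \<Longrightarrow> range (fold cayley_map w x) \<subseteq> G"
  by (induction w arbitrary: x) (simp_all add: cayley_map_closed)

text \<open>Each output symbol is the previous one (at first the state \<open>s\<close>) times the
  input symbol, so left cancellation decodes the input.\<close>

lemma cayley_map_inj:
  assumes "s \<in> G" "range x \<subseteq> G" "range y \<subseteq> G" and eq: "cayley_map s x = cayley_map s y"
  shows "x = y"
proof
  fix n
  show "x n = y n"
  proof (cases n)
    case 0
    then show ?thesis
      using assms(1-3) fun_cong[OF eq, of 0] left_cancel[of s "x 0" "y 0"]
      by (auto simp: cayley_map_0 image_subset_iff)
  next
    case (Suc m)
    have "cayley_map s y m \<in> G"
      using cayley_map_closed[OF assms(1,3)] by auto
    moreover have "cayley_map s y m * x n = cayley_map s y m * y n"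
      using Suc fun_cong[OF eq, of n] fun_cong[OF eq, of m] by (simp add: cayley_map_Suc)
    ultimately show ?thesis
      using assms left_cancel[of _ "x n" "y n"] by (auto simp: image_subset_iff)
  qed
qed

lemma section_word_closed: "set w \<subseteq> G \<Longrightarrow> t \<in> G \<Longrightarrow> set (section_word w t) \<subseteq> G"
  by (induction w arbitrary: t) (auto simp: closed)

text \<open>Right cancellation of \<open>t\<close> recovers the first letter, and with it the symbol
  passed on to the rest of the word.\<close>

lemma section_word_inj:
  "set v \<subseteq> G \<Longrightarrow> set w \<subseteq> G \<Longrightarrow> t \<in> G \<Longrightarrow> section_word v t = section_word w t \<Longrightarrow> v = w"
proof (induction v arbitrary: w t)
  case Nil
  then show ?case
    by (metis section_word.simps(1) section_word_eq_Nil_iff)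
next
  case (Cons a v)
  then obtain b w' where w: "w = b # w'"
    by (cases w) auto
  then have "a = b"
    using Cons.prems by (auto intro: right_cancel)
  with Cons.prems w Cons.IH[of w' "b * t"] show ?case
    by (simp add: closed)
qed

lemma acts_equallyD:
  assumes "acts_equally v w" "t \<in> G"
  shows "fold (*) v t = fold (*) w t" "acts_equally (section_word v t) (section_word w t)"
proof -
  have eq: "fold cayley_map v (case_nat t x) = fold cayley_map w (case_nat t x)"
    if "range x \<subseteq> G" for x
  proof -
    have "range (case_nat t x) \<subseteq> G"
      using that assms(2) by (auto simp: image_subset_iff split: nat.split)
    then show ?thesis
      using assms(1) by (simp add: acts_equally_def)
  qed
  show "fold (*) v t = fold (*) w t"
    using cayley_word_eqD(1)[OF eq[of "\<lambda>_. t"]] assms(2) by simp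
  show "acts_equally (section_word v t) (section_word w t)"
    unfolding acts_equally_def using cayley_word_eqD(2)[OF eq] by blast
qed

lemma acts_equally_snocD:
  assumes "acts_equally (v @ [a]) (w @ [a])" "set v \<subseteq> G" "set w \<subseteq> G" "a \<in> G"
  shows "acts_equally v w"
  unfolding acts_equally_def
proof (intro allI impI)
  fix x :: "nat \<Rightarrow> 'a"
  assume x: "range x \<subseteq> G"
  show "fold cayley_map v x = fold cayley_map w x"
  proof (rule cayley_map_inj[OF assms(4)])
    show "cayley_map a (fold cayley_map v x) = cayley_map a (fold cayley_map w x)"
      using assms(1) x by (simp add: acts_equally_def)
  qed (use assms x fold_cayley_map_closed in auto)
qed

text \<open>Both sections end in the common first output. The map of this letter is applied last and
  is injective on sequences over \<open>G\<close>, so it can be removed.\<close>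

lemma acts_equally_section_snocD:
  assumes eq: "acts_equally (v @ [a]) (w @ [b])"
    and G: "set (v @ [a]) \<subseteq> G" "set (w @ [b]) \<subseteq> G" "t \<in> G"
  shows "acts_equally (section_word v t) (section_word w t)"
proof -
  let ?c = "fold (*) (v @ [a]) t"
  have 1: "acts_equally (section_word v t @ [?c]) (section_word w t @ [?c])"
    using acts_equallyD(2)[OF eq G(3)] acts_equallyD(1)[OF eq G(3)]
    by (simp only: section_word_snoc)
  have 2: "set (section_word v t) \<subseteq> G" "set (section_word w t) \<subseteq> G" "?c \<in> G"
    using section_word_closed[OF G(1) G(3)] section_word_closed[OF G(2) G(3)]
    by (simp_all only: section_word_snoc) simp_all
  show ?thesis
    by (rule acts_equally_snocD[OF 1 2])
qed

text \<open>Sections without their last letters are shorter and still act equally, hence coincide by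
  induction. Their last letters agree as outputs, and a word is determined by its section.\<close>

lemma acts_equally_same_length_imp_eq:
  assumes "length v = length w" "acts_equally v w" "set v \<subseteq> G" "set w \<subseteq> G"
  shows "v = w"
  using assms
proof (induction "length v" arbitrary: v w)
  case 0
  then show ?case by simp
next
  case (Suc n)
  obtain v' a where v: "v = v' @ [a]"
    using Suc.hyps(2) by (metis length_0_conv nat.distinct(1) rev_exhaust)
  obtain w' b where w: "w = w' @ [b]"
    using Suc.hyps(2) Suc.prems(1) by (metis length_0_conv nat.distinct(1) rev_exhaust)
  \<comment> \<open>The letter \<open>a\<close> doubles as the input symbol, being an element of
    \<open>G\<close> at hand.\<close>
  have a: "a \<in> G"
    using Suc.prems v by simp
  have "section_word v' a = section_word w' a"
  proof (rule Suc.hyps(1))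
    show "acts_equally (section_word v' a) (section_word w' a)"
      using Suc.prems v w a by (intro acts_equally_section_snocD[of v' a w' b]) auto
  qed (use Suc.hyps(2) Suc.prems v w a section_word_closed in auto)
  then have "section_word v a = section_word w a"
    using acts_equallyD(1)[OF Suc.prems(2) a] unfolding v w section_word_snoc by simp
  then show ?case
    using Suc.prems a section_word_inj by blast
qed

text \<open>If \<open>w\<close> acts trivially, so do its sections at \<open>s\<close> and at
  \<open>t\<close>. These have the same length and therefore coincide, but their first letters
  \<open>a * s\<close> and \<open>a * t\<close> differ.\<close>

lemma acts_equally_Nil_imp_Nil:
  assumes "acts_equally [] w" "set w \<subseteq> G" and st: "s \<in> G" "t \<in> G" "s \<noteq> t"
  shows "w = []"
proof (rule ccontr)
  assume "w \<noteq> []"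
  then obtain a v where w: "w = a # v"
    by (cases w) auto
  have "acts_equally (section_word w s) (section_word w t)"
    using acts_equallyD(2)[OF assms(1) st(1)] acts_equallyD(2)[OF assms(1) st(2)]
    by (simp add: acts_equally_def)
  then have "section_word w s = section_word w t"
    using assms by (intro acts_equally_same_length_imp_eq) (simp_all add: section_word_closed)
  then have "a * s = a * t"
    using w by simp
  then show False
    using assms w left_cancel by auto
qed

text \<open>It remains to compare lengths, again by passing to sections without their last letters
  until one word is empty. Two distinct elements are essential: over a one-element \<open>G\<close>
  all words act equally.\<close>

lemma acts_equally_imp_eq:
  assumes st: "s \<in> G" "t \<in> G" "s \<noteq> t"
    and eq: "acts_equally v w" and G: "set v \<subseteq> G" "set w \<subseteq> G"
  shows "v = w"
proof -
  have "length v = length w"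
    using eq G
  proof (induction "length v" arbitrary: v w)
    case 0
    then show ?case
      using acts_equally_Nil_imp_Nil st by simp
  next
    case (Suc n)
    obtain v' a where v: "v = v' @ [a]"
      using Suc.hyps(2) by (metis length_0_conv nat.distinct(1) rev_exhaust)
    have "w \<noteq> []"
    proof
      assume "w = []"
      then have "acts_equally [] v"
        using Suc.prems by (simp add: acts_equally_def)
      then show False
        using acts_equally_Nil_imp_Nil st Suc.prems v by blast
    qed
    then obtain w' b where w: "w = w' @ [b]"
      by (metis rev_exhaust)
    have "length (section_word v' s) = length (section_word w' s)"
    proof (rule Suc.hyps(1))
      show "acts_equally (section_word v' s) (section_word w' s)"
        using Suc.prems v w st by (intro acts_equally_section_snocD[of v' a w' b]) auto
    qed (use Suc.hyps(2) Suc.prems v w st section_word_closed in auto)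
    then show ?case
      by (simp add: v w)
  qed
  then show ?thesis
    using acts_equally_same_length_imp_eq eq G by blast
qed

end

section \<open>The conditions imply freeness\<close>

lemma cayley_semigroup_free_if_conditions:
  fixes K :: "'a::{semigroup_mult, finite} set"
  assumes K: "is_minimal_ideal K" and R: "K \<in> UNIV // green_R"
    and H: "\<And>H. H \<in> UNIV // green_H \<Longrightarrow> H \<subseteq> K \<Longrightarrow> \<not> is_singleton H"
    and k: "k \<in> K" "\<And>s t. s * t = s * k * t"
  shows "is_free_semigroup (cayley_semigroup :: ((nat \<Rightarrow> 'a) \<Rightarrow> (nat \<Rightarrow> 'a)) set) trans_mult"
proof -
  have idl: "is_ideal K"
    using K by (simp add: is_minimal_ideal_def)
  \<comment> \<open>The elements that can be inserted into every product form a subsemigroup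
    containing \<open>k\<close>, so \<open>k\<close> can be replaced by an idempotent
    \<open>e\<close>.\<close>
  let ?A = "{a \<in> K. \<forall>s t. s * t = s * a * t}"
  have "a * b \<in> ?A" if "a \<in> ?A" "b \<in> ?A" for a b
  proof -
    have "s * t = s * (a * b) * t" for s t
    proof -
      have "s * t = s * b * t" "s * b = s * a * b"
        using that by blast+
      then show ?thesis
        by (metis mult.assoc)
    qed
    moreover have "a * b \<in> K"
      using that idl by (blast intro: is_ideal_mult)
    ultimately show ?thesis
      by blast
  qed
  moreover have "k \<in> ?A"
    using k by blast
  ultimately obtain e where "e \<in> ?A" and e_idem: "e * e = e"
    using idempotent_in_subsemigroup[of ?A] by blast
  then have e: "e \<in> K" "e * e = e" "\<And>s t. s * e * t = s * t"
    by (blast, blast, metis (mono_tags, lifting) mem_Collect_eq)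
  have R_e: "right_principal a = right_principal e" if "a \<in> K" for a
    using R that e(1) by (auto simp: quotient_def green_R_def)
  have left_id: "e * a = a" if "a \<in> K" for a
    using R_e[OF that] e(2) idempotent_right_principal right_principal_self by metis
  \<comment> \<open>This is \<open>Se\<close>, shown below to be a group with identity
    \<open>e\<close>.\<close>
  define G where "G = range (\<lambda>s. s * e)"
  have G_K: "G \<subseteq> K"
    using idl e(1) by (auto simp: G_def is_ideal_mult)
  have right_id: "a * e = a" if "a \<in> G" for a
    using that e(2) by (auto simp: G_def mult.assoc)
  have G_mult: "s * a \<in> G" if "a \<in> G" for s a
    using that by (auto simp: G_def mult.assoc[symmetric])
  have e_G: "e \<in> G"
    using e(2) by (metis G_def rangeI)
  \<comment> \<open>As \<open>K\<close> is one R-class, \<open>e = a * t\<close> for some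
    \<open>t\<close> unless \<open>e = a\<close>; multiplying by \<open>e\<close> moves
    \<open>t\<close> into \<open>G\<close>.\<close>
  have right_inv: "\<exists>b\<in>G. a * b = e" if "a \<in> G" for a
  proof -
    have "e \<in> right_principal a"
      using R_e[of a] right_principal_self that G_K by blast
    then consider "e = a" | t where "e = a * t"
      by (auto simp: right_principal_def)
    then show ?thesis
    proof cases
      case 1
      then show ?thesis
        using e(2) e_G by blast
    next
      case 2
      have "a * (t * e) = e"
        using 2 e(2) by (metis mult.assoc)
      then show ?thesis
        using G_mult[OF e_G] by blast
    qed
  qed
  \<comment> \<open>A right inverse \<open>c\<close> of the right inverse \<open>b\<close> of
    \<open>a\<close> is \<open>a\<close> itself.\<close>
  have left_inv: "\<exists>b\<in>G. b * a = e" if a: "a \<in> G" for a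
  proof -
    obtain b where b: "b \<in> G" "a * b = e"
      using right_inv[OF a] by blast
    obtain c where c: "c \<in> G" "b * c = e"
      using right_inv[OF b(1)] by blast
    have "a = a * (b * c)"
      using right_id[OF a] c(2) by simp
    also have "\<dots> = c"
      using b(2) left_id c(1) G_K by (auto simp: mult.assoc[symmetric])
    finally show ?thesis
      using b c by blast
  qed
  interpret cancellative_subsemigroup G
  proof
    fix a b c
    assume abc: "a \<in> G" "b \<in> G" "c \<in> G"
    show "a * b \<in> G"
      using abc G_mult by blast
    show "b = c" if "a * b = a * c"
    proof -
      obtain a' where "a' * a = e"
        using left_inv[OF abc(1)] by blast
      then show ?thesis
        using that left_id abc G_K by (metis mult.assoc subsetD)
    qed
    show "b = c" if "b * a = c * a"
    proof -
      obtain a' where "a * a' = e"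
        using right_inv[OF abc(1)] by blast
      then show ?thesis
        using that right_id abc by (metis mult.assoc)
    qed
  qed
  obtain g where g: "g \<in> G" "g \<noteq> e"
  proof -
    \<comment> \<open>The H-class of \<open>e\<close> lies in \<open>Se\<close>, so its second
      element is a non-identity element of \<open>G\<close>.\<close>
    let ?H = "green_H `` {e}"
    have "?H \<in> UNIV // green_H"
      by (auto simp: quotient_def)
    moreover have "?H \<subseteq> K"
    proof
      fix x
      assume "x \<in> ?H"
      then have "x \<in> right_principal e"
        using right_principal_self by (auto simp: green_H_def green_R_def)
      then show "x \<in> K"
        using right_principal_in_ideal[OF idl e(1)] by blast
    qed
    ultimately have "\<not> is_singleton ?H"
      by (rule H)
    moreover have "e \<in> ?H"
      using equiv_class_self[OF equiv_green_H] by blast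
    ultimately obtain g where g: "g \<in> ?H" "g \<noteq> e"
      by (auto simp: is_singleton_def)
    then have "g \<in> left_principal e"
      using left_principal_self by (auto simp: green_H_def green_L_def)
    then have "g * e = g"
      using idempotent_left_principal e(2) by blast
    then have "g \<in> G"
      by (metis G_def rangeI)
    then show thesis
      using that g by blast
  qed
  have map_e: "cayley_map (s * e) = cayley_map s" for s
    by (rule cayley_map_eqI) (rule e(3))
  show ?thesis
  proof (rule cayley_semigroup_freeI)
    fix v w :: "'a list"
    assume eq: "fold cayley_map v = fold cayley_map w"
    \<comment> \<open>Moves a word into \<open>G\<close> letter by letter without changing any of
      the maps.\<close>
    let ?r = "map (\<lambda>s. s * e)"
    have fold_r: "fold cayley_map (?r u) = fold cayley_map u" for u
      by (simp add: fold_map comp_def map_e)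
    have map_r: "map cayley_map (?r u) = map cayley_map u" for u
      by (simp add: comp_def map_e)
    have "acts_equally (?r v) (?r w)"
      unfolding acts_equally_def fold_r eq by simp
    then have "?r v = ?r w"
      using g e_G by (intro acts_equally_imp_eq) (auto simp: G_def)
    then show "map cayley_map v = map cayley_map w"
      using map_r by metis
  qed
qed

section \<open>Freeness implies the conditions\<close>

lemma conditions_if_cayley_semigroup_free:
  fixes K :: "'a::{semigroup_mult, finite} set"
  assumes K: "is_minimal_ideal K"
    and free: "is_free_semigroup (cayley_semigroup :: ((nat \<Rightarrow> 'a) \<Rightarrow> (nat \<Rightarrow> 'a)) set) trans_mult"
  shows "K \<in> UNIV // green_R"
    and "H \<in> UNIV // green_H \<Longrightarrow> H \<subseteq> K \<Longrightarrow> \<not> is_singleton H"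
    and "\<exists>k\<in>K. \<forall>s t. s * t = s * k * t"
proof -
  note freeD = cayley_semigroup_freeD[OF free]
  have idl: "is_ideal K" and min: "\<And>I. is_ideal I \<Longrightarrow> I \<subseteq> K \<Longrightarrow> I = K"
    using K by (auto simp: is_minimal_ideal_def)
  \<comment> \<open>After \<open>cayley_map a\<close> the first symbol begins with \<open>a\<close>,
    so \<open>b\<close> and \<open>c\<close> give the same first output; all later outputs arise
    from it by the same multiplications.\<close>
  have cancel: "b * x = c * x" if ba: "b * a = c * a" for a b c x :: 'a
  proof -
    have "fold cayley_map [a, b] = fold cayley_map [a, c]"
    proof (intro ext)
      fix x n
      have "b * cayley_map a x 0 = c * cayley_map a x 0"
        using ba by (simp add: cayley_map_0 mult.assoc[symmetric])
      then show "fold cayley_map [a, b] x n = fold cayley_map [a, c] x n"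
        by (induction n) (simp_all add: cayley_map_0[of b] cayley_map_0[of c]
          cayley_map_Suc[of b] cayley_map_Suc[of c])
    qed
    then show ?thesis
      using freeD[of "[a, b]" "[a, c]"] cayley_map_eqD by auto
  qed
  have absorb: "s * e * t = s * t" if "e * e = e" for s e t :: 'a
    by (rule cancel[of _ e]) (simp add: mult.assoc that)
  \<comment> \<open>The words \<open>e e\<close> and \<open>f e\<close> act equally, because the
    second letter \<open>e\<close> absorbs the idempotent that begins each symbol it reads.\<close>
  have idem_eq: "e * x = f * x" if "e * e = e" "f * f = f" for e f x :: 'a
  proof -
    have "fold cayley_map [e, e] = fold cayley_map [f, e]"
    proof (intro ext)
      fix x n
      have "cayley_map e (cayley_map e x) n = cayley_map e (cayley_map f x) n"
      proof (induction n)
        case 0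
        then show ?case
          using absorb[OF that(2), of e] that(1)
          by (simp add: cayley_map_0 mult.assoc[symmetric])
      next
        case (Suc n)
        \<comment> \<open>By absorption both sides are \<open>a\<close> times the product of
          \<open>x 0\<close>, ..., \<open>x m\<close>.\<close>
        have absorb_run: "a * cayley_map g x m = a * cayley_map e x m"
          if "g * g = g" for a g :: 'a and m
        proof (induction m)
          case 0
          show ?case
            using absorb[OF that, of a] absorb[OF \<open>e * e = e\<close>, of a]
            by (simp add: cayley_map_0 mult.assoc[symmetric])
        next
          case (Suc m)
          then show ?case
            by (simp add: cayley_map_Suc mult.assoc[symmetric])
        qed
        show ?case
          using absorb_run[OF that(2)] Suc by (simp add: cayley_map_Suc[of e "cayley_map e x"]
            cayley_map_Suc[of e "cayley_map f x"])
      qed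
      then show "fold cayley_map [e, e] x n = fold cayley_map [f, e] x n"
        by simp
    qed
    then show ?thesis
      using freeD[of "[e, e]" "[f, e]"] cayley_map_eqD by auto
  qed
  \<comment> \<open>An idempotent \<open>f\<close> in the left ideal of \<open>s * e\<close>
    satisfies \<open>f * e = f\<close>, while \<open>idem_eq\<close> gives \<open>f * e = e\<close>.
    So \<open>e\<close> is the idempotent attached to \<open>s * e\<close>, and it commutes with
    it.\<close>
  have se: "e \<in> left_principal (s * e)" "e * (s * e) = s * e" if e: "e * e = e" for e s :: 'a
  proof -
    obtain f where f: "f * f = f" "s * e * f = f * (s * e)" "f \<in> left_principal (s * e)"
      using idempotent_power[of "s * e"] by metis
    have "f * e = f"
      using f(3) left_principal_mono[of "s * e" e] left_principal_mult[OF left_principal_self]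
        idempotent_left_principal[OF e] by blast
    then have "f = e"
      using idem_eq[OF f(1) e, of e] e by simp
    with f show "e \<in> left_principal (s * e)"
      by simp
    show "e * (s * e) = s * e"
      using f(2) \<open>f = e\<close> e by (simp add: mult.assoc)
  qed
  obtain e where e: "e \<in> K" "e * e = e"
    using idempotent_in_subsemigroup[of K] idl by (auto simp: is_ideal_def)
  \<comment> \<open>Since \<open>s * e = e * s * e\<close>, the right ideal \<open>eS\<close> is
    two-sided, and minimality applies.\<close>
  have eS: "range ((*) e) = K"
  proof (rule min)
    have "s * (e * x) \<in> range ((*) e)" for s x
      using se(2)[OF e(2), of s] by (metis mult.assoc rangeI)
    then show "is_ideal (range ((*) e))"
      by (auto simp: is_ideal_def mult.assoc)
    show "range ((*) e) \<subseteq> K"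
      using idl e(1) by (auto simp: is_ideal_mult)
  qed
  have left_id: "e * a = a" if "a \<in> K" for a
    using that e(2) unfolding eS[symmetric] by (auto simp: mult.assoc[symmetric])
  \<comment> \<open>By \<open>idem_eq\<close> any idempotent in the right ideal of \<open>a\<close>
    acts on \<open>K\<close> as the left identity \<open>e\<close> does, so this ideal contains
    \<open>K\<close>.\<close>
  have R_K: "right_principal a = K" if a: "a \<in> K" for a
  proof -
    obtain f where f: "f * f = f" "f \<in> right_principal a"
      using idempotent_power[of a] by metis
    have "K \<subseteq> right_principal a"
    proof
      fix x
      assume "x \<in> K"
      then have "x = f * x"
        using left_id idem_eq[OF e(2) f(1)] by metis
      then show "x \<in> right_principal a"
        using right_principal_mult[OF f(2)] by metis
    qed
    then show ?thesis
      using right_principal_in_ideal[OF idl a] by blast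
  qed
  show "K \<in> UNIV // green_R"
  proof -
    have "green_R `` {e} = K"
      using R_K e(1) right_principal_self by (auto simp: green_R_def)
    then show ?thesis
      by (auto simp: quotient_def)
  qed
  show "\<exists>k\<in>K. \<forall>s t. s * t = s * k * t"
    using e absorb by metis
  show "\<not> is_singleton H" if "H \<in> UNIV // green_H" "H \<subseteq> K"
  proof
    assume "is_singleton H"
    then obtain a where H: "H = {a}"
      by (auto simp: is_singleton_def)
    have a: "a \<in> K"
      using H that(2) by simp
    from that(1) H have Ha: "green_H `` {a} = {a}"
      using equiv_class_eq[OF equiv_green_H] by (auto elim!: quotientE)
    have H_eq: "b = a" if "b \<in> K" "a \<in> left_principal b" "b \<in> left_principal a" for b
    proof -
      have "(a, b) \<in> green_H"
        using left_principal_eqI[OF that(2,3)] R_K[OF a] R_K[OF that(1)]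
        by (simp add: green_H_def green_R_def green_L_def)
      then show ?thesis
        using Ha by blast
    qed
    obtain f where f: "f * f = f" "a * f = f * a" "f \<in> right_principal a" "f \<in> left_principal a"
      by (rule idempotent_power)
    have fK: "f \<in> K"
      using f(3) R_K[OF a] by simp
    \<comment> \<open>Here \<open>a * f = f * a = e * a = a\<close>. Thus \<open>f\<close> is
      H-related to \<open>a\<close>, and a trivial H-class forces \<open>a\<close> to be
      idempotent.\<close>
    have "a * f = a"
      using f(2) left_id[OF a] idem_eq[OF e(2) f(1)] by metis
    then have "a \<in> left_principal f"
      by (metis left_principal_mult left_principal_self)
    then have "f = a"
      using H_eq fK f(4) by blast
    then have idem_a: "a * a = a"
      using f(1) by simp
    \<comment> \<open>By \<open>se\<close>, \<open>s * a\<close> is L-related to \<open>a\<close>,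
      and all of \<open>K\<close> is one R-class. Absorbing \<open>a\<close> then makes every
      product depend on its right factor alone, so \<open>a a\<close> and \<open>a\<close> act
      equally despite their different lengths.\<close>
    have "s * a = a" for s
    proof (rule H_eq)
      show "s * a \<in> K"
        using idl a by (rule is_ideal_mult)
      show "s * a \<in> left_principal a"
        by (rule left_principal_mult[OF left_principal_self])
      show "a \<in> left_principal (s * a)"
        by (rule se(1)[OF idem_a])
    qed
    then have St: "s * t = a * t" for s t
      using absorb[OF idem_a, of s t] by simp
    have "fold cayley_map [a, a] = fold cayley_map [a]"
    proof (intro ext)
      fix x n
      have "cayley_map a (cayley_map a x) n = cayley_map a x n"
      proof (cases n)
        case 0
        then show ?thesis
          by (simp add: cayley_map_0 mult.assoc[symmetric] idem_a)
      next
        case (Suc m)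
        have "cayley_map a (cayley_map a x) n =
            cayley_map a (cayley_map a x) m * cayley_map a x m * x n"
          unfolding Suc cayley_map_Suc by (simp only: mult.assoc)
        also have "\<dots> = a * x n"
          by (rule St)
        also have "\<dots> = cayley_map a x n"
          unfolding Suc cayley_map_Suc by (rule St[symmetric])
        finally show ?thesis .
      qed
      then show "fold cayley_map [a, a] x n = fold cayley_map [a] x n"
        by simp
    qed
    then show False
      using freeD[of "[a, a]" "[a]"] by simp
  qed
qed

theorem proposition1p4:
  fixes K :: "'a::{semigroup_mult, finite} set"
  assumes "is_minimal_ideal K"
  shows "is_free_semigroup (cayley_semigroup :: ((nat \<Rightarrow> 'a) \<Rightarrow> (nat \<Rightarrow> 'a)) set) trans_mult \<longleftrightarrow>
    K \<in> UNIV // green_R \<and>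
    (\<forall>H \<in> UNIV // green_H. H \<subseteq> K \<longrightarrow> \<not> is_singleton H) \<and>
    (\<exists>k\<in>K. \<forall>s t. s * t = s * k * t)"
proof (intro iffI conjI ballI impI)
  assume "K \<in> UNIV // green_R \<and> (\<forall>H \<in> UNIV // green_H. H \<subseteq> K \<longrightarrow> \<not> is_singleton H) \<and>
    (\<exists>k\<in>K. \<forall>s t. s * t = s * k * t)"
  then obtain k where k: "k \<in> K" "\<forall>s t. s * t = s * k * t"
    and RH: "K \<in> UNIV // green_R" "\<forall>H \<in> UNIV // green_H. H \<subseteq> K \<longrightarrow> \<not> is_singleton H"
    by (elim conjE bexE)
  show "is_free_semigroup (cayley_semigroup :: ((nat \<Rightarrow> 'a) \<Rightarrow> (nat \<Rightarrow> 'a)) set) trans_mult"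
    by (rule cayley_semigroup_free_if_conditions[OF assms RH(1) RH(2)[rule_format] k(1) k(2)[rule_format]])
qed (rule conditions_if_cayley_semigroup_free[OF assms]; assumption)+

end
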